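(* Let $\alpha>-1$ be real and let $z\ge 0$ be real. Let $(\widetilde P^{(0,\alpha)}_n)_{n\ge 0}$ be the sequence of monic shifted Jacobi polynomials, orthogonal with respect to the weight function $\omega(x)=x^\alpha$ on $[0,1]$. For $n=0,1,2,\ldots$ define the modified moments $$m_n(\alpha,z)=\int_0^1 \widetilde P_n^{(0,\alpha)}(x)\,x^\alpha e^{-zx}\,dx .$$ Then $$m_0(\alpha,z)=\begin{cases}\dfrac{1}{\alpha+1}, & z=0,\\[8pt] \dfrac{\widehat\gamma(\alpha+1,z)}{z^{\alpha+1}}, & z>0,\end{cases}$$ and for every $n\ge 1$, $$m_n(\alpha,z)=(-1)^n\,\frac{n!}{\big((\alpha+n+1)_n\big)^2\,(\alpha+2n+1)}\;z^n e^{-z}\;{}_1F_1(n+1;\,\alpha+2n+2;\,z).$$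
   Context: For each $n\ge 0$, $\widetilde P_n^{(0,\alpha)}$ is the unique monic polynomial of degree $n$ such that $\int_0^1 \widetilde P_n^{(0,\alpha)}(x)\,q(x)\,x^\alpha\,dx=0$ for every polynomial $q$ of degree less than $n$. Equivalently, $\widetilde P_n^{(0,\alpha)}(x)=2^{-n}P_n^{(0,\alpha)}(2x-1)$, where $P_n^{(0,\alpha)}$ is the monic Jacobi polynomial of degree $n$ orthogonal on $[-1,1]$ with respect to the weight $(1+x)^\alpha$. The Pochhammer symbol is $(a)_0=1$, $(a)_k=a(a+1)\cdots(a+k-1)$ for $k\ge 1$. The incomplete gamma function is $\widehat\gamma(a,z)=\int_0^z x^{a-1}e^{-x}\,dx$ (for $a>0$, $z>0$). The hypergeometric function is ${}_1F_1(a;b;x)=\sum_{k=0}^\infty \frac{(a)_k}{(b)_k}\frac{x^k}{k!}$. *)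

theory Defs
  imports "HOL-Analysis.Analysis" "HOL-Computational_Algebra.Polynomial"
begin

text \<open>
  The integrals are gauge integrals over closed intervals. For \<open>\<alpha> > -1\<close> and \<open>a > 0\<close> all integrands
  below are absolutely integrable, so these are the usual (Lebesgue, or improper Riemann) integrals;
  the convention \<open>0 powr a = 0\<close> only matters at the single point \<open>0\<close>.
\<close>

definition is_shifted_jacobi :: "real \<Rightarrow> nat \<Rightarrow> real poly \<Rightarrow> bool" where
  "is_shifted_jacobi \<alpha> n p \<longleftrightarrow>
     degree p = n \<and> lead_coeff p = 1 \<and>
     (\<forall>q :: real poly. q = 0 \<or> degree q < n \<longrightarrow>
        integral {0..1} (\<lambda>x. poly p x * poly q x * x powr \<alpha>) = 0)"

text \<open>
  The disjunct \<open>q = 0\<close> above reflects that the zero polynomial has \<open>degree\<close> \<open>0\<close> here instead of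
  minus infinity. The polynomial below is determined for \<open>\<alpha> > -1\<close> only.
\<close>

definition shifted_jacobi :: "real \<Rightarrow> nat \<Rightarrow> real poly" where
  "shifted_jacobi \<alpha> n = (THE p. is_shifted_jacobi \<alpha> n p)"

definition modified_moment :: "nat \<Rightarrow> real \<Rightarrow> real \<Rightarrow> real" where
  "modified_moment n \<alpha> z =
     integral {0..1} (\<lambda>x. poly (shifted_jacobi \<alpha> n) x * x powr \<alpha> * exp (- z * x))"

definition lower_incomplete_Gamma :: "real \<Rightarrow> real \<Rightarrow> real" where
  "lower_incomplete_Gamma a z = integral {0..z} (\<lambda>x. x powr (a - 1) * exp (- x))"

definition hypergeo_1F1 :: "real \<Rightarrow> real \<Rightarrow> real \<Rightarrow> real" where
  "hypergeo_1F1 a b x = (\<Sum>k. pochhammer a k / pochhammer b k * (x ^ k / fact k))"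

end

theory Submission
  imports Defs
begin

text \<open>
  Writing \<open>D\<close> for differentiation, the monic shifted Jacobi polynomial is given by Rodrigues' formula
  \<open>(\<alpha> + n + 1)\<^sub>n x\<^sup>\<alpha> P\<^sub>n(x) = D\<^sup>n (x\<^sup>\<alpha>\<^sup>+\<^sup>n (x - 1)\<^sup>n)\<close>. Integrating by parts \<open>n\<close> times therefore turns
  \<open>\<integral> P\<^sub>n(x) x\<^sup>\<alpha> s(x) dx\<close> into a multiple of \<open>\<integral> x\<^sup>\<alpha>\<^sup>+\<^sup>n (x - 1)\<^sup>n (D\<^sup>n s)(x) dx\<close>. For a polynomial \<open>s\<close> of
  degree less than \<open>n\<close> this gives orthogonality. For \<open>s(x) = exp (-z x)\<close> one expands
  \<open>exp (-z x) = exp (-z) exp (z (1 - x))\<close> in powers of \<open>1 - x\<close> and integrates termwise; the Beta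
  integrals that appear are the terms of the hypergeometric series.
\<close>

subsection \<open>Rodrigues' formula\<close>

text \<open>\<open>rodrigues \<beta> n r\<close> is the polynomial \<open>x\<^sup>-\<^sup>\<beta> D\<^sup>n (x\<^sup>\<beta>\<^sup>+\<^sup>n r)\<close>.\<close>

primrec rodrigues :: "real \<Rightarrow> nat \<Rightarrow> real poly \<Rightarrow> real poly" where
  "rodrigues \<beta> 0 r = r"
| "rodrigues \<beta> (Suc n) r =
     smult (\<beta> + 1) (rodrigues (\<beta> + 1) n r) + pCons 0 (pderiv (rodrigues (\<beta> + 1) n r))"

text \<open>On monomials the operator is diagonal: the \<open>n\<close>-th derivative of
  \<open>x^(\<beta>+n+i)\<close> is \<open>x^(\<beta>+i)\<close> times a rising factorial.\<close>

lemma coeff_rodrigues: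
  "coeff (rodrigues \<beta> n r) i = pochhammer (\<beta> + real i + 1) n * coeff r i"
proof (induction n arbitrary: \<beta>)
  case (Suc n)
  define p where "p = rodrigues (\<beta> + 1) n r"
  have "coeff (rodrigues \<beta> (Suc n) r) i = (\<beta> + real i + 1) * coeff p i"
    by (cases i) (simp_all add: p_def coeff_pderiv algebra_simps)
  also have "coeff p i = pochhammer (\<beta> + real i + 1 + 1) n * coeff r i"
    unfolding p_def Suc.IH by (simp add: add_ac)
  finally show ?case
    by (simp only: pochhammer_rec mult.assoc)
qed simp

text \<open>Each differentiation lowers the multiplicity of the root \<open>-c\<close> by at most
  one. With \<open>c = -1\<close> and \<open>k = 1\<close> this makes the boundary terms at 1
  vanish.\<close>

lemma linear_power_dvd_rodrigues:
  assumes "[:c, 1:] ^ (k + n) dvd r"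
  shows "[:c, 1:] ^ k dvd rodrigues \<beta> n r"
  using assms
proof (induction n arbitrary: \<beta> k)
  case (Suc n)
  define p where "p = rodrigues (\<beta> + 1) n r"
  have "[:c, 1:] ^ Suc k dvd p"
    unfolding p_def using Suc.prems by (intro Suc.IH) simp
  then obtain u where u: "p = [:c, 1:] ^ Suc k * u" ..
  have "pderiv p = [:c, 1:] ^ k * (smult (real (Suc k)) u + [:c, 1:] * pderiv u)"
    unfolding u pderiv_mult pderiv_power_Suc
    by (simp add: pderiv_pCons algebra_simps del: of_nat_Suc)
  then have "[:c, 1:] ^ k dvd pderiv p"
    by simp
  moreover have "[:c, 1:] ^ k dvd p"
    using \<open>[:c, 1:] ^ Suc k dvd p\<close> by (rule power_le_dvd) simp
  moreover have "pCons 0 (pderiv p) = [:0, 1:] * pderiv p"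
    by simp
  ultimately show ?case
    by (simp only: rodrigues.simps flip: p_def) (intro dvd_add dvd_smult dvd_mult)
qed simp

text \<open>One integration by parts, since \<open>x^\<beta> ((\<beta>+1) r + x r')\<close> is the
  derivative of \<open>x^(\<beta>+1) r\<close>.\<close>

lemma has_integral_parts_powr:
  fixes r :: "real poly" and s s' :: "real \<Rightarrow> real"
  assumes \<beta>: "\<beta> > -1" and r: "poly r 1 = 0"
    and s: "\<And>x. (s has_real_derivative s' x) (at x)"
    and J: "((\<lambda>x. poly r x * x powr (\<beta> + 1) * s' x) has_integral J) {0..1}"
  shows "((\<lambda>x. poly (smult (\<beta> + 1) r + pCons 0 (pderiv r)) x * x powr \<beta> * s x) has_integral - J) {0..1}"
proof -
  define F where "F x = poly r x * x powr (\<beta> + 1) * s x" for x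
  define G where "G x = poly (smult (\<beta> + 1) r + pCons 0 (pderiv r)) x * x powr \<beta> * s x" for x
  define H where "H x = poly r x * x powr (\<beta> + 1) * s' x" for x
  have "continuous_on {0..1} s"
    using s DERIV_continuous continuous_at_imp_continuous_on by blast
  then have "continuous_on {0..1} F"
    unfolding F_def using \<beta> by (intro continuous_intros continuous_on_powr') auto
  moreover have "(F has_vector_derivative G x + H x) (at x)" if "x \<in> {0<..<1}" for x
  proof -
    have x: "x > 0" using that by simp
    then have *: "x powr (\<beta> + 1) = x * x powr \<beta>"
      by (simp add: powr_add)
    have "(F has_real_derivative G x + H x) (at x)"
      unfolding F_def
      by (rule DERIV_cong[OF DERIV_mult[OF DERIV_mult[OF poly_DERIV has_real_derivative_powr[OF x]] s]])
         (simp only: G_def H_def *, simp add: algebra_simps)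
    then show ?thesis
      by (simp add: has_real_derivative_iff_has_vector_derivative)
  qed
  \<comment> \<open>\<open>G\<close> may be singular at 0 when \<open>\<beta> < 0\<close>, so
    differentiability is used only in the interior; \<open>F\<close> is continuous up to the
    endpoints.\<close>
  ultimately have "((\<lambda>x. G x + H x) has_integral F 1 - F 0) {0..1}"
    by (intro fundamental_theorem_of_calculus_interior) auto
  then have "((\<lambda>x. G x + H x - H x) has_integral F 1 - F 0 - J) {0..1}"
    using J unfolding H_def by (rule has_integral_diff)
  \<comment> \<open>Both boundary terms vanish: \<open>F 1\<close> by the root of \<open>r\<close>,
    \<open>F 0\<close> because \<open>0 powr (\<beta> + 1) = 0\<close>.\<close>
  then show ?thesis
    using r by (simp add: G_def F_def)
qed

text \<open>The family \<open>s\<close> lists the successive derivatives of the test function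
  \<open>s 0\<close>. The induction treats the \<open>n\<close> inner derivatives with
  \<open>\<beta> + 1\<close> and the shifted family, then moves the outermost one.\<close>

lemma has_integral_rodrigues:
  fixes r :: "real poly" and s :: "nat \<Rightarrow> real \<Rightarrow> real"
  assumes "\<beta> > -1" and "[:-1, 1:] ^ n dvd r"
    and "\<And>i x. (s i has_real_derivative s (Suc i) x) (at x)"
    and "((\<lambda>x. poly r x * x powr (\<beta> + real n) * s n x) has_integral J) {0..1}"
  shows "((\<lambda>x. poly (rodrigues \<beta> n r) x * x powr \<beta> * s 0 x) has_integral (-1) ^ n * J) {0..1}"
  using assms
proof (induction n arbitrary: \<beta> s)
  case (Suc n)
  have "[:-1, 1:] ^ n dvd r"
    using Suc.prems(2) by (rule power_le_dvd) simp
  moreover have "((\<lambda>x. poly r x * x powr (\<beta> + 1 + real n) * s (Suc n) x) has_integral J) {0..1}"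
    using Suc.prems(4) by (simp add: add_ac)
  ultimately have "((\<lambda>x. poly (rodrigues (\<beta> + 1) n r) x * x powr (\<beta> + 1) * s (Suc 0) x)
      has_integral (-1) ^ n * J) {0..1}"
    using Suc.prems(1) by (intro Suc.IH[where s = "\<lambda>i. s (Suc i)"] Suc.prems(3)) auto
  \<comment> \<open>Of the \<open>n + 1\<close> zeros at 1, the inner derivatives use up at most
    \<open>n\<close>; one is left.\<close>
  moreover have "[:-1, 1:] ^ 1 dvd rodrigues (\<beta> + 1) n r"
    using Suc.prems(2) by (intro linear_power_dvd_rodrigues) simp
  then have "poly (rodrigues (\<beta> + 1) n r) 1 = 0"
    by (simp add: poly_eq_0_iff_dvd)
  ultimately show ?case
    using has_integral_parts_powr[OF Suc.prems(1) _ Suc.prems(3), of "rodrigues (\<beta> + 1) n r" 0]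
    by simp
qed simp

subsection \<open>Shifted Jacobi polynomials\<close>

definition jacobi_rodrigues :: "real \<Rightarrow> nat \<Rightarrow> real poly" where
  "jacobi_rodrigues \<alpha> n =
     smult (inverse (pochhammer (\<alpha> + real n + 1) n)) (rodrigues \<alpha> n ([:-1, 1:] ^ n))"

lemma pochhammer_jacobi_pos:
  assumes "\<alpha> > -1"
  shows "pochhammer (\<alpha> + real n + 1) n > 0"
  using assms by (cases "n = 0") (auto intro!: pochhammer_pos)

lemma is_shifted_jacobi_rodrigues:
  assumes \<alpha>: "\<alpha> > -1"
  shows "is_shifted_jacobi \<alpha> n (jacobi_rodrigues \<alpha> n)"
proof -
  note pos = pochhammer_jacobi_pos[OF \<alpha>, of n]
  have coeff: "coeff (jacobi_rodrigues \<alpha> n) i = inverse (pochhammer (\<alpha> + real n + 1) n) *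
      (pochhammer (\<alpha> + real i + 1) n * coeff ([:-1, 1:] ^ n) i)" for i
    by (simp add: jacobi_rodrigues_def coeff_rodrigues)
  have lead: "coeff (jacobi_rodrigues \<alpha> n) n = 1"
    using pos by (simp add: coeff coeff_linear_power)
  have "degree (jacobi_rodrigues \<alpha> n) \<le> n"
    by (intro degree_le) (simp add: coeff coeff_eq_0 degree_linear_power)
  then have deg: "degree (jacobi_rodrigues \<alpha> n) = n"
    using lead by (intro antisym le_degree) auto
  have "integral {0..1} (\<lambda>x. poly (jacobi_rodrigues \<alpha> n) x * poly q x * x powr \<alpha>) = 0"
    if q: "q = 0 \<or> degree q < n" for q
  proof -
    \<comment> \<open>Hence the integral left after \<open>n\<close> integrations by parts has
      integrand 0.\<close>
    have "(pderiv ^^ n) q = 0"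
      using q by (auto simp: poly_eq_iff coeff_higher_pderiv coeff_eq_0)
    then have "((\<lambda>x. poly (rodrigues \<alpha> n ([:-1, 1:] ^ n)) x * x powr \<alpha> * poly ((pderiv ^^ 0) q) x)
        has_integral (-1) ^ n * 0) {0..1}"
      using \<alpha> by (intro has_integral_rodrigues[where s = "\<lambda>i. poly ((pderiv ^^ i) q)"])
        (auto simp: poly_DERIV)
    then have "((\<lambda>x. inverse (pochhammer (\<alpha> + real n + 1) n) *
        (poly (rodrigues \<alpha> n ([:-1, 1:] ^ n)) x * x powr \<alpha> * poly q x)) has_integral
        inverse (pochhammer (\<alpha> + real n + 1) n) * 0) {0..1}"
      by (intro has_integral_mult_right) simp
    then show ?thesis
      by (intro integral_unique) (simp add: jacobi_rodrigues_def mult_ac)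
  qed
  then show ?thesis
    using lead deg by (simp add: is_shifted_jacobi_def)
qed

text \<open>For \<open>\<alpha> < 0\<close> the weight is unbounded near 0, so continuity does not
  suffice; the integrand is a bounded measurable factor times an absolutely integrable one.\<close>

lemma poly_powr_integrable:
  fixes p :: "real poly"
  assumes "\<alpha> > -1"
  shows "(\<lambda>x. poly p x * x powr \<alpha>) integrable_on {0..1}"
proof -
  have "(\<lambda>x. x powr \<alpha>) integrable_on {0..1}"
    using has_integral_powr_from_0[OF assms, of 1] by (auto simp: integrable_on_def)
  then have "(\<lambda>x. x powr \<alpha>) absolutely_integrable_on {0..1}"
    by (intro nonnegative_absolutely_integrable_1) auto
  moreover have cont: "continuous_on {0..1} (poly p)"
    by (intro continuous_intros)
  then have "poly p \<in> borel_measurable (lebesgue_on {0..1})"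
    by (intro continuous_imp_measurable_on_sets_lebesgue) auto
  moreover have "bounded (poly p ` {0..1})"
    using cont by (intro compact_imp_bounded compact_continuous_image) auto
  ultimately have "(\<lambda>x. poly p x * x powr \<alpha>) absolutely_integrable_on {0..1}"
    by (intro absolutely_integrable_bounded_measurable_product_real) auto
  then show ?thesis
    by (rule set_lebesgue_integral_eq_integral(1))
qed

text \<open>A continuous nonnegative minorant of the integrand has integral 0, hence vanishes, which
  gives \<open>d\<close> infinitely many roots.\<close>

lemma poly_eq_0_if_integral_square_powr_0:
  fixes d :: "real poly"
  assumes \<alpha>: "\<alpha> > -1" and int: "integral {0..1} (\<lambda>x. poly d x * poly d x * x powr \<alpha>) = 0"
  shows "d = 0"
proof -
  txt \<open>For \<open>\<alpha> < 0\<close> the integrand is discontinuous at \<open>0\<close>, hence the extra factor \<open>x\<close>.\<close>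
  define f where "f x = poly (d * d) x * x powr (\<alpha> + 1)" for x
  have nonneg: "f x \<ge> 0" for x
    by (simp add: f_def)
  have cont: "continuous_on {0..1} f"
    unfolding f_def using \<alpha> by (intro continuous_intros continuous_on_powr') auto
  have "integral {0..1} f \<le> integral {0..1} (\<lambda>x. poly (d * d) x * x powr \<alpha>)"
  proof (rule integral_le)
    show "f integrable_on {0..1}"
      using cont by (rule integrable_continuous_interval)
    show "(\<lambda>x. poly (d * d) x * x powr \<alpha>) integrable_on {0..1}"
      using \<alpha> by (rule poly_powr_integrable)
    show "f x \<le> poly (d * d) x * x powr \<alpha>" if "x \<in> {0..1}" for x
      unfolding f_def using that
      by (intro mult_left_mono) (auto simp: powr_add mult_left_le)
  qed
  then have "integral {0..1} f \<le> 0"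
    using int by simp
  moreover have "integral {0..1} f \<ge> 0"
    using cont nonneg by (intro integral_nonneg integrable_continuous_interval) auto
  ultimately have "\<forall>x\<in>{0..1}. f x = 0"
    using cont nonneg by (subst integral_eq_0_iff[symmetric]) auto
  then have "{0<..<1} \<subseteq> {x. poly d x = 0}"
    by (auto simp: f_def)
  moreover have "infinite {0<..<1::real}"
    by (rule infinite_Ioo) simp
  ultimately show ?thesis
    using poly_roots_finite finite_subset by blast
qed

text \<open>The leading terms cancel in \<open>p - q\<close>, so it is an admissible test polynomial
  for both \<open>p\<close> and \<open>q\<close> and is orthogonal to itself.\<close>

lemma is_shifted_jacobi_unique:
  assumes \<alpha>: "\<alpha> > -1" and p: "is_shifted_jacobi \<alpha> n p" and q: "is_shifted_jacobi \<alpha> n q"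
  shows "p = q"
proof -
  have "degree (p - q) \<le> n"
    using p q degree_diff_le_max[of p q] by (auto simp: is_shifted_jacobi_def)
  moreover have "coeff (p - q) n = 0"
    using p q by (auto simp: is_shifted_jacobi_def)
  ultimately have d: "p - q = 0 \<or> degree (p - q) < n"
    by (metis leading_coeff_0_iff le_neq_implies_less)
  have "integral {0..1} (\<lambda>x. poly (p - q) x * poly (p - q) x * x powr \<alpha>) =
      integral {0..1} (\<lambda>x. poly (p * (p - q)) x * x powr \<alpha> - poly (q * (p - q)) x * x powr \<alpha>)"
    by (simp add: algebra_simps)
  also have "\<dots> = integral {0..1} (\<lambda>x. poly (p * (p - q)) x * x powr \<alpha>) -
      integral {0..1} (\<lambda>x. poly (q * (p - q)) x * x powr \<alpha>)"
    by (intro integral_diff poly_powr_integrable \<alpha>)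
  also have "\<dots> = 0"
    using p q d by (simp only: is_shifted_jacobi_def poly_mult)
  finally show ?thesis
    using poly_eq_0_if_integral_square_powr_0[OF \<alpha>, of "p - q"] by simp
qed

lemma shifted_jacobi_eq_rodrigues:
  assumes "\<alpha> > -1"
  shows "shifted_jacobi \<alpha> n = jacobi_rodrigues \<alpha> n"
  unfolding shifted_jacobi_def
  by (rule the_equality)
     (use is_shifted_jacobi_rodrigues[OF assms] is_shifted_jacobi_unique[OF assms] in blast)+

subsection \<open>Modified moments\<close>

text \<open>This is the Beta integral \<open>B(a, m+1)\<close>, with the Gamma quotient rewritten as
  a rising factorial.\<close>

lemma has_integral_powr_mult_power:
  fixes a :: real
  assumes a: "a > 0"
  shows "((\<lambda>x. x powr (a - 1) * (1 - x) ^ m) has_integral fact m / pochhammer a (Suc m)) {0..1}"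
proof -
  have "((\<lambda>x. x powr (a - 1) * (1 - x) powr (real m + 1 - 1)) has_integral Beta a (real m + 1)) {0..1}"
    using a by (intro has_integral_Beta_real) auto
  \<comment> \<open>For \<open>m = 0\<close> the integrands differ at \<open>x = 1\<close>, where
    \<open>0 powr 0 = 0\<close> but \<open>0 ^ 0 = 1\<close>.\<close>
  then have "((\<lambda>x. x powr (a - 1) * (1 - x) ^ m) has_integral Beta a (real m + 1)) {0..1}"
    by (rule has_integral_spike_finite[of "{1}", rotated 2]) (auto simp: powr_realpow)
  moreover have "a \<notin> \<int>\<^sub>\<le>\<^sub>0"
    using a by auto
  then have "Beta a (real m + 1) = fact m / pochhammer a (Suc m)"
    using Gamma_fact[of m, where ?'a = real] a Gamma_real_pos[OF a]
    by (simp add: Beta_def pochhammer_Gamma add_ac del: pochhammer_Suc)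
  ultimately show ?thesis
    by simp
qed

lemma has_integral_powr_power_exp:
  fixes \<alpha> z :: real
  assumes \<alpha>: "\<alpha> > -1" and n: "n \<ge> 1"
  shows "((\<lambda>x. x powr (\<alpha> + real n) * (1 - x) ^ n * exp (- z * x)) has_integral
    fact n / (pochhammer (\<alpha> + real n + 1) n * (\<alpha> + 2 * real n + 1)) * exp (- z) *
      hypergeo_1F1 (real n + 1) (\<alpha> + 2 * real n + 2) z) {0..1}"
proof -
  define a where "a = \<alpha> + real n + 1"
  \<comment> \<open>The positive exponent \<open>a - 1\<close>, due to \<open>n \<ge> 1\<close>,
    makes \<open>w\<close> continuous and bounded by 1 on the interval, so the series converges
    uniformly there.\<close>
  have a: "a > 0" "a - 1 > 0"
    using \<alpha> n by (auto simp: a_def)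
  define w where "w x = x powr (a - 1) * (1 - x) ^ n" for x
  define f where "f k x = w x * ((z * (1 - x)) ^ k / fact k)" for k x
  \<comment> \<open>\<open>C\<close> is the Beta integral for \<open>k = 0\<close>; dividing it out
    of the \<open>k\<close>-th integral leaves the hypergeometric term \<open>t k\<close>.\<close>
  define C where "C = fact n / (pochhammer a n * (a + real n))"
  define t where "t k = pochhammer (real n + 1) k / pochhammer (a + real n + 1) k * (z ^ k / fact k)" for k
  have w_cont: "continuous_on {0..1} w"
    unfolding w_def using a by (intro continuous_intros continuous_on_powr') auto
  have f_int: "(f k has_integral C * t k) {0..1}" for k
  proof -
    have poch: "pochhammer a (Suc (n + k)) =
        pochhammer a n * (a + real n) * pochhammer (a + real n + 1) k"
      using pochhammer_product'[of a n "Suc k"] by (simp add: pochhammer_rec)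
    have fct: "fact (n + k) = fact n * pochhammer (real n + 1) k"
      using pochhammer_product'[of "1::real" n k] by (simp add: add_ac flip: pochhammer_fact)
    have "((\<lambda>x. z ^ k / fact k * (x powr (a - 1) * (1 - x) ^ (n + k))) has_integral
        z ^ k / fact k * (fact (n + k) / pochhammer a (Suc (n + k)))) {0..1}"
      using a by (intro has_integral_mult_right has_integral_powr_mult_power)
    moreover have "z ^ k / fact k * (fact (n + k) / pochhammer a (Suc (n + k))) = C * t k"
      by (simp only: poch fct C_def t_def) (simp add: mult_ac)
    moreover have "(\<lambda>x. z ^ k / fact k * (x powr (a - 1) * (1 - x) ^ (n + k))) = f k"
      by (auto simp: f_def w_def power_add power_mult_distrib)
    ultimately show ?thesis
      by simp
  qed
  have "uniform_limit {0..1} (\<lambda>N x. \<Sum>k<N. f k x) (\<lambda>x. \<Sum>k. f k x) sequentially"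
  proof (rule Weierstrass_m_test)
    show "summable (\<lambda>k. \<bar>z\<bar> ^ k / fact k)"
      using summable_exp[of "\<bar>z\<bar>"] by (simp add: field_simps)
    show "norm (f k x) \<le> \<bar>z\<bar> ^ k / fact k" if x: "x \<in> {0..1}" for k x
    proof -
      have "x powr (a - 1) \<le> 1" "\<bar>1 - x\<bar> ^ n \<le> 1"
        using x a by (auto intro!: powr_le1 power_le_one)
      then have "\<bar>w x\<bar> \<le> 1"
        unfolding w_def abs_mult power_abs by (intro mult_le_one) auto
      moreover have "\<bar>z * (1 - x)\<bar> ^ k \<le> \<bar>z\<bar> ^ k"
        using x by (intro power_mono) (auto simp: abs_mult mult_left_le)
      ultimately have "\<bar>w x\<bar> * \<bar>z * (1 - x)\<bar> ^ k \<le> 1 * \<bar>z\<bar> ^ k"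
        by (intro mult_mono) auto
      then show ?thesis
        by (simp add: f_def abs_mult power_abs divide_right_mono)
    qed
  qed
  moreover have "continuous_on {0..1} (\<lambda>x. \<Sum>k<N. f k x)" for N
    unfolding f_def by (intro continuous_intros w_cont) auto
  ultimately obtain I J where IJ: "\<And>N. ((\<lambda>x. \<Sum>k<N. f k x) has_integral I N) {0..1}"
      "((\<lambda>x. \<Sum>k. f k x) has_integral J) {0..1}" "I \<longlonglongrightarrow> J"
    by (rule uniform_limit_integral) auto
  have "I = (\<lambda>N. \<Sum>k<N. C * t k)"
    using f_int by (intro ext has_integral_unique[OF IJ(1)] has_integral_sum) auto
  with IJ(3) have "(\<lambda>k. C * t k) sums J"
    by (simp add: sums_def)
  \<comment> \<open>Needed to deduce summability of \<open>t\<close> from that of its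
    multiple.\<close>
  moreover have "C \<noteq> 0"
    using pochhammer_jacobi_pos[OF \<alpha>, of n] a by (auto simp: C_def a_def)
  ultimately have "J = C * (\<Sum>k. t k)"
    by (metis sums_unique sums_mult_D suminf_mult sums_summable)
  also have "(\<Sum>k. t k) = hypergeo_1F1 (real n + 1) (\<alpha> + 2 * real n + 2) z"
    by (simp add: hypergeo_1F1_def t_def a_def algebra_simps)
  finally have "((\<lambda>x. exp (- z) * (\<Sum>k. f k x)) has_integral exp (- z) *
      (C * hypergeo_1F1 (real n + 1) (\<alpha> + 2 * real n + 2) z)) {0..1}"
    using IJ(2) by (intro has_integral_mult_right) simp
  moreover have "exp (- z) * (\<Sum>k. f k x) = w x * exp (- z * x)" for x
  proof -
    have "(\<lambda>k. f k x) sums (w x * exp (z * (1 - x)))"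
      unfolding f_def using exp_converges[of "z * (1 - x)"]
      by (intro sums_mult) (simp add: field_simps)
    then show ?thesis
      by (simp add: sums_iff algebra_simps flip: exp_add)
  qed
  ultimately show ?thesis
    by (simp add: w_def C_def a_def algebra_simps)
qed

text \<open>The Pochhammer factor is squared because it occurs once in the normalisation of the
  polynomial and once in the Beta integrals.\<close>

lemma modified_moment_pos:
  fixes \<alpha> z :: real
  assumes \<alpha>: "\<alpha> > -1" and n: "n \<ge> 1"
  shows "modified_moment n \<alpha> z =
           (-1) ^ n * (fact n / ((pochhammer (\<alpha> + real n + 1) n)\<^sup>2 * (\<alpha> + 2 * real n + 1)))
             * z ^ n * exp (- z) * hypergeo_1F1 (real n + 1) (\<alpha> + 2 * real n + 2) z"
proof -
  define P where "P = pochhammer (\<alpha> + real n + 1) n"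
  define K where "K = fact n / (P * (\<alpha> + 2 * real n + 1)) * exp (- z) *
      hypergeo_1F1 (real n + 1) (\<alpha> + 2 * real n + 2) z"
  have "((\<lambda>x. z ^ n * (x powr (\<alpha> + real n) * (1 - x) ^ n * exp (- z * x))) has_integral z ^ n * K) {0..1}"
    unfolding K_def P_def
    by (intro has_integral_mult_right has_integral_powr_power_exp \<alpha> n)
  moreover have "z ^ n * (x powr (\<alpha> + real n) * (1 - x) ^ n * exp (- z * x)) =
      poly ([:-1, 1:] ^ n) x * x powr (\<alpha> + real n) * ((- z) ^ n * exp (- z * x))" for x
  proof -
    \<comment> \<open>The signs of \<open>(x - 1)^n\<close> and of the \<open>n\<close>-th
      derivative of the exponential cancel, so the final \<open>(-1)^n\<close> comes from the
      integrations by parts alone.\<close>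
    have "(z * (1 - x)) ^ n = ((x - 1) * - z) ^ n"
      by (rule arg_cong[where f = "\<lambda>y. y ^ n"]) algebra
    then have "z ^ n * (1 - x) ^ n = (x - 1) ^ n * (- z) ^ n"
      by (simp only: power_mult_distrib)
    then show ?thesis
      by (simp add: poly_power mult_ac)
  qed
  ultimately have "((\<lambda>x. poly ([:-1, 1:] ^ n) x * x powr (\<alpha> + real n) * ((- z) ^ n * exp (- z * x)))
      has_integral z ^ n * K) {0..1}"
    by (simp only:)
  then have "((\<lambda>x. poly (rodrigues \<alpha> n ([:-1, 1:] ^ n)) x * x powr \<alpha> * ((- z) ^ 0 * exp (- z * x)))
      has_integral (-1) ^ n * (z ^ n * K)) {0..1}"
    by (intro has_integral_rodrigues[where s = "\<lambda>i x. (- z) ^ i * exp (- z * x)"] \<alpha> dvd_refl)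
       (auto intro!: derivative_eq_intros)
  then have "((\<lambda>x. inverse P * (poly (rodrigues \<alpha> n ([:-1, 1:] ^ n)) x * x powr \<alpha> * exp (- z * x)))
      has_integral inverse P * ((-1) ^ n * (z ^ n * K))) {0..1}"
    by (intro has_integral_mult_right) simp
  then have "modified_moment n \<alpha> z = inverse P * ((-1) ^ n * (z ^ n * K))"
    unfolding modified_moment_def shifted_jacobi_eq_rodrigues[OF \<alpha>]
    by (intro integral_unique) (simp add: jacobi_rodrigues_def P_def mult.assoc)
  then show ?thesis
    by (simp add: K_def power2_eq_square divide_simps mult_ac flip: P_def)
qed

lemma modified_moment_0:
  fixes \<alpha> z :: real
  assumes \<alpha>: "\<alpha> > -1" and z: "z \<ge> 0"
  shows "modified_moment 0 \<alpha> z =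
           (if z = 0 then 1 / (\<alpha> + 1)
            else lower_incomplete_Gamma (\<alpha> + 1) z / z powr (\<alpha> + 1))"
proof -
  have eq: "modified_moment 0 \<alpha> z = integral {0..1} (\<lambda>x. x powr \<alpha> * exp (- z * x))"
    by (simp add: modified_moment_def shifted_jacobi_eq_rodrigues[OF \<alpha>] jacobi_rodrigues_def)
  show ?thesis
  proof (cases "z = 0")
    case True
    then show ?thesis
      using has_integral_powr_from_0[OF \<alpha>, of 1] eq by (simp add: integral_unique)
  next
    case False
    then have z: "z > 0" using z by simp
    have img: "(\<lambda>x. x / z) ` {0..z} = {0..1}"
      using z by (simp add: image_divide_atLeastAtMost)
    \<comment> \<open>Substituting \<open>z * x\<close> for \<open>x\<close> gives one factor
      \<open>z\<close>; the weight supplies the remaining \<open>z powr \<alpha>\<close>.\<close>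
    have "lower_incomplete_Gamma (\<alpha> + 1) z / z =
        integral {0..1} (\<lambda>x. (z * x) powr \<alpha> * exp (- (z * x)))"
      using integral_stretch_real[of z 0 z "\<lambda>x. x powr \<alpha> * exp (- x)"] z
      by (simp add: lower_incomplete_Gamma_def img)
    also have "\<dots> = integral {0..1} (\<lambda>x. z powr \<alpha> * (x powr \<alpha> * exp (- z * x)))"
      using z by (intro integral_cong) (simp add: powr_mult)
    also have "\<dots> = z powr \<alpha> * modified_moment 0 \<alpha> z"
      by (simp add: eq)
    finally show ?thesis
      using z by (simp add: powr_add field_simps)
  qed
qed

theorem proposition3p2:
  fixes \<alpha> z :: real
  assumes "\<alpha> > -1" and "z \<ge> 0"
  shows "modified_moment 0 \<alpha> z =
           (if z = 0 then 1 / (\<alpha> + 1)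
            else lower_incomplete_Gamma (\<alpha> + 1) z / z powr (\<alpha> + 1)) \<and>
         (\<forall>n\<ge>1. modified_moment n \<alpha> z =
           (-1) ^ n * (fact n / ((pochhammer (\<alpha> + real n + 1) n)\<^sup>2 * (\<alpha> + 2 * real n + 1)))
             * z ^ n * exp (- z) * hypergeo_1F1 (real n + 1) (\<alpha> + 2 * real n + 2) z)"
  using modified_moment_0[OF assms] modified_moment_pos[OF assms(1)] by blast

end
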